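(* Let $X$ be a directed space, and let $C(X)$ be the complete lattice of closed subsets of $X$ ordered by inclusion. The following are equivalent: (a) $X$ is core compact; (b) $(C(X),\sigma(C(X)))$ is core compact; (c) $(C(X),\sigma(C(X)))$ is sober and locally compact, and $\sigma(C(X))=\upsilon(C(X))$.
   Context: A topological space is core compact if its lattice of open sets is a continuous lattice. For a poset $P$, $\sigma(P)$ is the Scott topology and $\upsilon(P)$ is the upper topology (generated by the complements of the sets $\downarrow x$, $x\in P$). Order notions on a $T_0$ space $X$ refer to the specialization order ($x\sqsubseteq y$ iff $x\in\overline{\{y\}}$). Directed sets are nonempty. A directed set $D\subseteq X$ converges to $x$ ($D\to x$) if $D$ meets every open neighbourhood of $x$. A directed space is a $T_0$ space $X$ in which a subset $U$ is open whenever it satisfies: for every directed $D\subseteq X$ and $x\in U$ with $D\to x$, $D\cap U\neq\emptyset$. *)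

theory Defs
  imports "HOL-Analysis.Analysis" "HOL-Library.Lub_Glb"
begin

text \<open>
  A poset is given by a carrier set P in an ordered type, with the induced order; both lattices
  needed here (open sets, closed sets) are of this form, with \<open>\<subseteq>\<close> as the order.
  Suprema and infima are taken in the carrier: \<open>isLub P A s\<close> means that s is the least
  element of P among the upper bounds of A that lie in P.
\<close>

definition directed_wrt :: "('a \<Rightarrow> 'a \<Rightarrow> bool) \<Rightarrow> 'a set \<Rightarrow> bool" where
  "directed_wrt le D \<longleftrightarrow> D \<noteq> {} \<and> (\<forall>x\<in>D. \<forall>y\<in>D. \<exists>z\<in>D. le x z \<and> le y z)"

definition way_below :: "'a::order set \<Rightarrow> 'a \<Rightarrow> 'a \<Rightarrow> bool" where
  "way_below P x y \<longleftrightarrow>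
     (\<forall>D s. D \<subseteq> P \<and> directed_wrt (\<le>) D \<and> isLub P D s \<and> y \<le> s \<longrightarrow> (\<exists>d\<in>D. x \<le> d))"

definition continuous_poset :: "'a::order set \<Rightarrow> bool" where
  "continuous_poset P \<longleftrightarrow>
     (\<forall>x\<in>P. directed_wrt (\<le>) {y\<in>P. way_below P y x} \<and> isLub P {y\<in>P. way_below P y x} x)"

definition complete_lattice_on :: "'a::order set \<Rightarrow> bool" where
  "complete_lattice_on P \<longleftrightarrow> (\<forall>A\<subseteq>P. (\<exists>s. isLub P A s) \<and> (\<exists>i. isGlb P A i))"

definition continuous_lattice :: "'a::order set \<Rightarrow> bool" where
  "continuous_lattice P \<longleftrightarrow> complete_lattice_on P \<and> continuous_poset P"

definition scott_open :: "'a::order set \<Rightarrow> 'a set \<Rightarrow> bool" where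
  "scott_open P U \<longleftrightarrow> U \<subseteq> P \<and> (\<forall>x\<in>U. \<forall>y\<in>P. x \<le> y \<longrightarrow> y \<in> U) \<and>
     (\<forall>D s. D \<subseteq> P \<and> directed_wrt (\<le>) D \<and> isLub P D s \<and> s \<in> U \<longrightarrow> D \<inter> U \<noteq> {})"

definition scott_topology :: "'a::order set \<Rightarrow> 'a topology" where
  "scott_topology P = topology (scott_open P)"

text \<open>
  The carrier P is added to the subbasis because \<open>topology_generated_by\<close> takes the union
  of the generators as the underlying space, and a least element of P lies in no set
  \<open>P - {y \<in> P. y \<le> x}\<close>.
\<close>

definition upper_topology :: "'a::order set \<Rightarrow> 'a topology" where
  "upper_topology P = topology_generated_by (insert P {P - {y\<in>P. y \<le> x} |x. x \<in> P})"

definition core_compact :: "'a topology \<Rightarrow> bool" where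
  "core_compact X \<longleftrightarrow> continuous_lattice {U. openin X U}"

definition irreducible_closed_in :: "'a topology \<Rightarrow> 'a set \<Rightarrow> bool" where
  "irreducible_closed_in X F \<longleftrightarrow> closedin X F \<and> F \<noteq> {} \<and>
     (\<forall>A B. closedin X A \<and> closedin X B \<and> F \<subseteq> A \<union> B \<longrightarrow> F \<subseteq> A \<or> F \<subseteq> B)"

definition sober_space :: "'a topology \<Rightarrow> bool" where
  "sober_space X \<longleftrightarrow>
     (\<forall>F. irreducible_closed_in X F \<longrightarrow> (\<exists>!x. x \<in> topspace X \<and> F = X closure_of {x}))"

text \<open>
  Local compactness for not necessarily Hausdorff spaces: every point has a neighbourhood base of
  compact sets. The library's \<open>locally_compact_space\<close> only asks for one compact
  neighbourhood of each point, which is automatic in the Scott topology of a poset with a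
  least element.
\<close>

definition locally_compact :: "'a topology \<Rightarrow> bool" where
  "locally_compact X \<longleftrightarrow> neighbourhood_base_of (compactin X) X"

definition specialization :: "'a topology \<Rightarrow> 'a \<Rightarrow> 'a \<Rightarrow> bool" where
  "specialization X x y \<longleftrightarrow> x \<in> X closure_of {y}"

definition directed_in :: "'a topology \<Rightarrow> 'a set \<Rightarrow> bool" where
  "directed_in X D \<longleftrightarrow> D \<subseteq> topspace X \<and> directed_wrt (specialization X) D"

definition converges_in :: "'a topology \<Rightarrow> 'a set \<Rightarrow> 'a \<Rightarrow> bool" where
  "converges_in X D x \<longleftrightarrow> x \<in> topspace X \<and> (\<forall>U. openin X U \<and> x \<in> U \<longrightarrow> D \<inter> U \<noteq> {})"

definition directed_space :: "'a topology \<Rightarrow> bool" where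
  "directed_space X \<longleftrightarrow> t0_space X \<and>
     (\<forall>U \<subseteq> topspace X.
        (\<forall>D. \<forall>x\<in>U. directed_in X D \<and> converges_in X D x \<longrightarrow> D \<inter> U \<noteq> {}) \<longrightarrow> openin X U)"

definition closed_sets :: "'a topology \<Rightarrow> 'a set set" where
  "closed_sets X = {C. closedin X C}"

lemma scott_openD:
  assumes "scott_open P U"
  shows "U \<subseteq> P"
    and "\<And>x y. x \<in> U \<Longrightarrow> y \<in> P \<Longrightarrow> x \<le> y \<Longrightarrow> y \<in> U"
    and "\<And>D s. D \<subseteq> P \<Longrightarrow> directed_wrt (\<le>) D \<Longrightarrow> isLub P D s \<Longrightarrow> s \<in> U \<Longrightarrow> \<exists>d. d \<in> D \<and> d \<in> U"
proof -
  show "U \<subseteq> P" using assms by (simp add: scott_open_def)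
  show "y \<in> U" if "x \<in> U" "y \<in> P" "x \<le> y" for x y
    using assms that by (simp add: scott_open_def)
  show "\<exists>d. d \<in> D \<and> d \<in> U" if D: "D \<subseteq> P" "directed_wrt (\<le>) D" "isLub P D s" "s \<in> U" for D s
  proof -
    have "\<forall>D s. D \<subseteq> P \<and> directed_wrt (\<le>) D \<and> isLub P D s \<and> s \<in> U \<longrightarrow> D \<inter> U \<noteq> {}"
      using assms unfolding scott_open_def by (elim conjE)
    then have "D \<inter> U \<noteq> {}" using D by (elim allE[of _ D] allE[of _ s]) simp
    then show ?thesis by auto
  qed
qed

lemma scott_openI:
  assumes "U \<subseteq> P"
    and "\<And>x y. x \<in> U \<Longrightarrow> y \<in> P \<Longrightarrow> x \<le> y \<Longrightarrow> y \<in> U"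
    and "\<And>D s. D \<subseteq> P \<Longrightarrow> directed_wrt (\<le>) D \<Longrightarrow> isLub P D s \<Longrightarrow> s \<in> U \<Longrightarrow> \<exists>d. d \<in> D \<and> d \<in> U"
  shows "scott_open P U"
  unfolding scott_open_def
proof (intro conjI allI impI ballI)
  show "U \<subseteq> P" by fact
  show "y \<in> U" if "x \<in> U" "y \<in> P" "x \<le> y" for x y using assms(2) that .
  show "D \<inter> U \<noteq> {}" if D: "D \<subseteq> P \<and> directed_wrt (\<le>) D \<and> isLub P D s \<and> s \<in> U" for D s
  proof -
    obtain d where "d \<in> D" "d \<in> U" using assms(3)[of D s] D by (elim conjE) auto
    then show ?thesis by auto
  qed
qed

lemma istopology_scott_open: "istopology (scott_open P)"
  unfolding istopology_def
proof (intro conjI allI impI)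
  fix S T assume S: "scott_open P S" and T: "scott_open P T"
  show "scott_open P (S \<inter> T)"
  proof (rule scott_openI)
    show "S \<inter> T \<subseteq> P" using scott_openD(1)[OF S] by auto
  next
    fix x y assume "x \<in> S \<inter> T" "y \<in> P" "x \<le> y"
    then show "y \<in> S \<inter> T" using scott_openD(2)[OF S] scott_openD(2)[OF T] by auto
  next
    fix D s assume D: "D \<subseteq> P" "directed_wrt (\<le>) D" "isLub P D s" and s: "s \<in> S \<inter> T"
    obtain a where a: "a \<in> D" "a \<in> S" using scott_openD(3)[OF S D] s by auto
    obtain b where b: "b \<in> D" "b \<in> T" using scott_openD(3)[OF T D] s by auto
    obtain c where c: "c \<in> D" "a \<le> c" "b \<le> c"
      using D(2) a(1) b(1) unfolding directed_wrt_def by meson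
    have "c \<in> P" using c(1) D(1) by auto
    then have "c \<in> S" "c \<in> T"
      using scott_openD(2)[OF S a(2)] scott_openD(2)[OF T b(2)] c by auto
    then show "\<exists>d. d \<in> D \<and> d \<in> S \<inter> T" using c(1) by auto
  qed
next
  fix K assume K: "\<forall>S\<in>K. scott_open P S"
  show "scott_open P (\<Union> K)"
  proof (rule scott_openI)
    show "\<Union> K \<subseteq> P" using K scott_openD(1) by auto
  next
    fix x y assume "x \<in> \<Union> K" "y \<in> P" "x \<le> y"
    then obtain S where S: "S \<in> K" "x \<in> S" by auto
    then have "y \<in> S" using scott_openD(2)[of P S x y] K \<open>y \<in> P\<close> \<open>x \<le> y\<close> by auto
    then show "y \<in> \<Union> K" using S by auto
  next
    fix D s assume D: "D \<subseteq> P" "directed_wrt (\<le>) D" "isLub P D s" and "s \<in> \<Union> K"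
    then obtain S where S: "S \<in> K" "s \<in> S" by auto
    then have "\<exists>d. d \<in> D \<and> d \<in> S" using scott_openD(3)[of P S, OF _ D] K by auto
    then show "\<exists>d. d \<in> D \<and> d \<in> \<Union> K" using S by auto
  qed
qed

lemma openin_scott_topology: "openin (scott_topology P) U \<longleftrightarrow> scott_open P U"
  by (simp add: scott_topology_def istopology_scott_open topology_inverse')

lemma scott_open_carrier: "scott_open P P"
proof (rule scott_openI)
  fix D s assume "D \<subseteq> P" "directed_wrt (\<le>) D"
  moreover from this obtain d where "d \<in> D" unfolding directed_wrt_def by auto
  ultimately show "\<exists>d. d \<in> D \<and> d \<in> P" by auto
qed auto

lemma topspace_scott_topology [simp]: "topspace (scott_topology P) = P"
proof
  show "topspace (scott_topology P) \<subseteq> P"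
    using scott_openD(1) openin_topspace[of "scott_topology P"]
    unfolding openin_scott_topology by auto
  show "P \<subseteq> topspace (scott_topology P)"
    by (rule openin_subset) (simp add: openin_scott_topology scott_open_carrier)
qed

lemma topspace_upper_topology [simp]: "topspace (upper_topology P) = P"
  unfolding upper_topology_def topology_generated_by_topspace by auto

end

theory Submission
  imports Defs
begin

text \<open>
  A closed set is the directed supremum of the closures of its finite subsets, so a Scott open
  family \<open>H\<close> of closed sets is determined by the finite sets whose closure it contains. As \<open>X\<close> is
  directed, the points \<open>x\<close> with \<open>X closure_of {x} \<union> C \<in> H\<close> form an open set \<open>S C\<close>. If \<open>X\<close> is core
  compact, the closed sets \<open>C\<close> with \<open>V\<close> way below \<open>S C\<close> again form a Scott open family, and induction
  on the finite set produces, inside \<open>H\<close>, a finite intersection of families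
  \<open>hit X U = {C. C \<inter> U \<noteq> {}}\<close>. Hence the Scott and the upper topology agree, and sobriety and local
  compactness can be checked on the families \<open>hit X U\<close>. Conversely, local compactness implies core
  compactness, and the open sets of \<open>X\<close> are a retract of the Scott open families by maps that
  preserve unions.
\<close>

section \<open>Suprema, infima and directed sets\<close>

lemma isLub_iff:
  "isLub P A s \<longleftrightarrow> s \<in> P \<and> (\<forall>a\<in>A. a \<le> s) \<and> (\<forall>u\<in>P. (\<forall>a\<in>A. a \<le> u) \<longrightarrow> s \<le> u)"
  by (auto simp: isLub_def leastP_def isUb_def setle_def setge_def)

lemma isGlb_iff:
  "isGlb P A s \<longleftrightarrow> s \<in> P \<and> (\<forall>a\<in>A. s \<le> a) \<and> (\<forall>u\<in>P. (\<forall>a\<in>A. u \<le> a) \<longrightarrow> u \<le> s)"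
  by (auto simp: isGlb_def greatestP_def isLb_def setle_def setge_def)

lemma directed_wrtD:
  assumes "directed_wrt le D"
  shows "D \<noteq> {}" and "x \<in> D \<Longrightarrow> y \<in> D \<Longrightarrow> \<exists>z\<in>D. le x z \<and> le y z"
  using assms by (auto simp: directed_wrt_def)

lemma directed_wrt_image:
  assumes "directed_wrt le D" "\<And>x y. x \<in> D \<Longrightarrow> y \<in> D \<Longrightarrow> le x y \<Longrightarrow> le' (f x) (f y)"
  shows "directed_wrt le' (f ` D)"
  using assms unfolding directed_wrt_def by (auto; blast)

subsection \<open>Core compactness\<close>

lemma isLub_open:
  assumes "\<And>W. W \<in> D \<Longrightarrow> openin X W"
  shows "isLub {U. openin X U} D s \<longleftrightarrow> s = \<Union>D"
proof -
  have "openin X (\<Union>D)" using assms by auto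
  then show ?thesis unfolding isLub_iff by (auto; blast)
qed

lemma complete_lattice_on_open: "complete_lattice_on {U. openin X U}"
  unfolding complete_lattice_on_def
proof (intro allI impI conjI)
  fix A assume A: "A \<subseteq> {U. openin X U}"
  show "\<exists>s. isLub {U. openin X U} A s" using isLub_open[of A X] A by blast
  have "isGlb {U. openin X U} A (\<Union>{U. openin X U \<and> (\<forall>a\<in>A. U \<subseteq> a)})"
    unfolding isGlb_iff by auto
  then show "\<exists>i. isGlb {U. openin X U} A i" by blast
qed

text \<open>Suprema of open sets are unions, so the relation becomes a statement about directed open
  covers of \<open>U\<close>.\<close>

lemma way_below_open:
  "way_below {U. openin X U} V U \<longleftrightarrow>
     (\<forall>D. (\<forall>W\<in>D. openin X W) \<longrightarrow> directed_wrt (\<subseteq>) D \<longrightarrow> U \<subseteq> \<Union>D \<longrightarrow> (\<exists>W\<in>D. V \<subseteq> W))"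
proof
  assume L: "way_below {U. openin X U} V U"
  show "\<forall>D. (\<forall>W\<in>D. openin X W) \<longrightarrow> directed_wrt (\<subseteq>) D \<longrightarrow> U \<subseteq> \<Union>D \<longrightarrow> (\<exists>W\<in>D. V \<subseteq> W)"
  proof (intro allI impI)
    fix D assume D: "\<forall>W\<in>D. openin X W" "directed_wrt (\<subseteq>) D" "U \<subseteq> \<Union>D"
    then have "isLub {U. openin X U} D (\<Union>D)" by (simp add: isLub_open)
    with D show "\<exists>W\<in>D. V \<subseteq> W" using L unfolding way_below_def by blast
  qed
next
  assume R: "\<forall>D. (\<forall>W\<in>D. openin X W) \<longrightarrow> directed_wrt (\<subseteq>) D \<longrightarrow> U \<subseteq> \<Union>D \<longrightarrow> (\<exists>W\<in>D. V \<subseteq> W)"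
  show "way_below {U. openin X U} V U"
    unfolding way_below_def
  proof (intro allI impI)
    fix D s
    assume D: "D \<subseteq> {U. openin X U} \<and> directed_wrt (\<le>) D \<and> isLub {U. openin X U} D s \<and> U \<le> s"
    then have "s = \<Union>D" using isLub_open[of D X s] by blast
    with D R show "\<exists>W\<in>D. V \<le> W" by (elim allE[of _ D]) auto
  qed
qed

lemma way_below_openD:
  assumes "way_below {U. openin X U} V U" "\<And>W. W \<in> D \<Longrightarrow> openin X W"
    "directed_wrt (\<subseteq>) D" "U \<subseteq> \<Union>D"
  obtains W where "W \<in> D" "V \<subseteq> W"
  using assms unfolding way_below_open by blast

lemma way_below_open_mono:
  assumes "way_below {U. openin X U} V U" "V' \<subseteq> V" "U \<subseteq> U'"
  shows "way_below {U. openin X U} V' U'"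
  using assms unfolding way_below_open by (meson subset_trans)

lemma way_below_open_empty: "way_below {U. openin X U} {} U"
  unfolding way_below_open by (auto dest: directed_wrtD(1))

lemma way_below_open_Un:
  assumes "way_below {U. openin X U} V U" "way_below {U. openin X U} V' U"
  shows "way_below {U. openin X U} (V \<union> V') U"
  unfolding way_below_open
proof (intro allI impI)
  fix D assume D: "\<forall>W\<in>D. openin X W" "directed_wrt (\<subseteq>) D" "U \<subseteq> \<Union>D"
  obtain W where W: "W \<in> D" "V \<subseteq> W" using way_below_openD[OF assms(1)] D by metis
  obtain W' where W': "W' \<in> D" "V' \<subseteq> W'" using way_below_openD[OF assms(2)] D by metis
  obtain T where "T \<in> D" "W \<subseteq> T" "W' \<subseteq> T" using directed_wrtD(2)[OF D(2)] W W' by metis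
  then show "\<exists>W\<in>D. V \<union> V' \<subseteq> W" using W W' by blast
qed

lemma way_below_open_imp_subset:
  assumes "way_below {U. openin X U} V U" "openin X U"
  shows "V \<subseteq> U"
  using way_below_openD[OF assms(1), of "{U}"] assms(2) by (auto simp: directed_wrt_def)

text \<open>The lattice of open sets is always complete, and the open sets way below
  \<open>U\<close> are always directed: they include the empty set and are closed under binary
  unions. What remains of continuity is that they cover \<open>U\<close>.\<close>

lemma core_compact_iff:
  "core_compact X \<longleftrightarrow>
     (\<forall>U x. openin X U \<and> x \<in> U \<longrightarrow> (\<exists>V. openin X V \<and> x \<in> V \<and> way_below {W. openin X W} V U))"
proof -
  have dir: "directed_wrt (\<le>) {V \<in> {W. openin X W}. way_below {W. openin X W} V U}" for U
    unfolding directed_wrt_def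
  proof (intro conjI ballI)
    show "{V \<in> {W. openin X W}. way_below {W. openin X W} V U} \<noteq> {}"
      using way_below_open_empty[of X U] openin_empty[of X] by blast
    fix V V'
    assume V: "V \<in> {V \<in> {W. openin X W}. way_below {W. openin X W} V U}"
      "V' \<in> {V \<in> {W. openin X W}. way_below {W. openin X W} V U}"
    then have "V \<union> V' \<in> {V \<in> {W. openin X W}. way_below {W. openin X W} V U}"
      using way_below_open_Un by blast
    then show "\<exists>T\<in>{V \<in> {W. openin X W}. way_below {W. openin X W} V U}. V \<le> T \<and> V' \<le> T"
      by blast
  qed
  have lub: "isLub {W. openin X W} {V \<in> {W. openin X W}. way_below {W. openin X W} V U} U \<longleftrightarrow>
      (\<forall>x\<in>U. \<exists>V. openin X V \<and> x \<in> V \<and> way_below {W. openin X W} V U)" if "openin X U" for U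
    using way_below_open_imp_subset[OF _ that] by (subst isLub_open) auto
  show ?thesis
    unfolding core_compact_def continuous_lattice_def continuous_poset_def
    using complete_lattice_on_open[of X] dir lub by (simp; blast)
qed

lemma core_compactD:
  assumes "core_compact X" "openin X U" "x \<in> U"
  obtains V where "openin X V" "x \<in> V" "way_below {W. openin X W} V U"
  using assms unfolding core_compact_iff by blast

text \<open>A form of interpolation. The open sets way below some member of \<open>D\<close> form a
  directed family \<open>E\<close>, and core compactness makes \<open>E\<close> cover
  \<open>\<Union>D\<close>. So \<open>V\<close> lies inside a member of \<open>E\<close>, which is
  itself way below a member of \<open>D\<close>.\<close>

lemma way_below_open_Union:
  assumes X: "core_compact X" and V: "way_below {W. openin X W} V (\<Union>D)"
    and D: "\<And>W. W \<in> D \<Longrightarrow> openin X W" "directed_wrt (\<subseteq>) D"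
  obtains W where "W \<in> D" "way_below {W. openin X W} V W"
proof -
  define E where "E = {T. openin X T \<and> (\<exists>W\<in>D. way_below {W. openin X W} T W)}"
  have "directed_wrt (\<subseteq>) E"
    unfolding directed_wrt_def
  proof (intro conjI ballI)
    show "E \<noteq> {}"
      unfolding E_def using directed_wrtD(1)[OF D(2)] way_below_open_empty[of X] openin_empty[of X]
      by blast
    fix S T assume "S \<in> E" "T \<in> E"
    then obtain A B where AB: "A \<in> D" "B \<in> D" "way_below {W. openin X W} S A"
      "way_below {W. openin X W} T B" "openin X S" "openin X T"
      unfolding E_def by blast
    then obtain W where "W \<in> D" "A \<subseteq> W" "B \<subseteq> W" using directed_wrtD(2)[OF D(2)] by metis
    then have "S \<union> T \<in> E"
      unfolding E_def using AB way_below_open_Un way_below_open_mono by blast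
    then show "\<exists>z\<in>E. S \<subseteq> z \<and> T \<subseteq> z" by blast
  qed
  moreover have "\<Union>D \<subseteq> \<Union>E"
    unfolding E_def using D(1) core_compactD[OF X] by (smt (verit) Union_iff mem_Collect_eq subsetI)
  moreover have "openin X T" if "T \<in> E" for T using that by (simp add: E_def)
  ultimately obtain T where "T \<in> E" "V \<subseteq> T" using way_below_openD[OF V, of E] by metis
  then show thesis using that way_below_open_mono[of X T _ V] unfolding E_def by blast
qed

text \<open>A compact set \<open>K\<close> with \<open>V \<subseteq> K \<subseteq> U\<close> forces
  \<open>V\<close> to be way below \<open>U\<close>.\<close>

lemma locally_compact_imp_core_compact:
  assumes "locally_compact X"
  shows "core_compact X"
  unfolding core_compact_iff
proof (intro allI impI)
  fix U x assume "openin X U \<and> x \<in> U"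
  then obtain V K where VK: "openin X V" "compactin X K" "x \<in> V" "V \<subseteq> K" "K \<subseteq> U"
    using assms unfolding locally_compact_def neighbourhood_base_of by metis
  have "way_below {W. openin X W} V U"
    unfolding way_below_open
  proof (intro allI impI)
    fix D assume D: "\<forall>W\<in>D. openin X W" "directed_wrt (\<subseteq>) D" "U \<subseteq> \<Union>D"
    then obtain F where F: "finite F" "F \<subseteq> D" "K \<subseteq> \<Union>F"
      using VK unfolding compactin_def by (metis subset_trans)
    \<comment> \<open>Directedness merges the finite subcover of \<open>K\<close> into a single
      member of \<open>D\<close>.\<close>
    from F(1,2) have "\<exists>W\<in>D. \<Union>F \<subseteq> W"
    proof (induction F)
      case empty
      then show ?case using directed_wrtD(1)[OF D(2)] by auto
    next
      case (insert T F)
      then obtain W where W: "W \<in> D" "\<Union>F \<subseteq> W" by auto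
      moreover have "T \<in> D" using insert.prems by simp
      ultimately obtain S where "S \<in> D" "T \<subseteq> S" "W \<subseteq> S"
        using directed_wrtD(2)[OF D(2)] by metis
      then show ?case using W by (intro bexI[of _ S]) auto
    qed
    then show "\<exists>W\<in>D. V \<subseteq> W" using F(3) VK(4) by (meson order_trans)
  qed
  then show "\<exists>V. openin X V \<and> x \<in> V \<and> way_below {W. openin X W} V U" using VK by blast
qed

subsection \<open>The Scott topology on closed sets\<close>

text \<open>For open \<open>U\<close> these are the subbasic open sets of the lower Vietoris
  topology.\<close>

definition hit :: "'a topology \<Rightarrow> 'a set \<Rightarrow> 'a set set" where
  "hit X U = {C. closedin X C \<and> C \<inter> U \<noteq> {}}"

lemma mem_closed_sets: "C \<in> closed_sets X \<longleftrightarrow> closedin X C"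
  by (simp add: closed_sets_def)

lemma isLub_closed_sets:
  assumes "D \<subseteq> closed_sets X"
  shows "isLub (closed_sets X) D s \<longleftrightarrow> s = X closure_of \<Union>D"
proof -
  have D: "\<Union>D \<subseteq> topspace X" using assms by (auto simp: closed_sets_def dest: closedin_subset)
  have "isLub (closed_sets X) D (X closure_of \<Union>D)"
    unfolding isLub_iff closed_sets_def
    using closure_of_subset[OF D] closure_of_minimal[of "\<Union>D" _ X] by (auto simp: Sup_le_iff)
  then show ?thesis unfolding isLub_iff by (metis order_antisym)
qed

lemma scott_open_closed_sets_mono:
  assumes "scott_open (closed_sets X) H" "A \<in> H" "A \<subseteq> B" "closedin X B"
  shows "B \<in> H"
  using scott_openD(2)[OF assms(1,2)] assms by (auto simp: closed_sets_def)

lemma scott_open_closed_setsD: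
  assumes "scott_open (closed_sets X) H" "\<And>C. C \<in> D \<Longrightarrow> closedin X C" "directed_wrt (\<subseteq>) D"
    "X closure_of \<Union>D \<in> H"
  obtains C where "C \<in> D" "C \<in> H"
proof -
  have D: "D \<subseteq> closed_sets X" using assms(2) by (auto simp: closed_sets_def)
  then show thesis
    using scott_openD(3)[OF assms(1) D assms(3)] isLub_closed_sets[OF D] assms(4) that by blast
qed

lemma scott_open_closed_setsI:
  assumes "\<And>C. C \<in> H \<Longrightarrow> closedin X C"
    and "\<And>A B. A \<in> H \<Longrightarrow> closedin X B \<Longrightarrow> A \<subseteq> B \<Longrightarrow> B \<in> H"
    and "\<And>D. (\<And>C. C \<in> D \<Longrightarrow> closedin X C) \<Longrightarrow> directed_wrt (\<subseteq>) D \<Longrightarrow> X closure_of \<Union>D \<in> H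
      \<Longrightarrow> \<exists>C\<in>D. C \<in> H"
  shows "scott_open (closed_sets X) H"
proof (rule scott_openI)
  show "H \<subseteq> closed_sets X" using assms(1) by (auto simp: closed_sets_def)
  show "\<And>x y. x \<in> H \<Longrightarrow> y \<in> closed_sets X \<Longrightarrow> x \<le> y \<Longrightarrow> y \<in> H"
    using assms(2) by (auto simp: closed_sets_def)
  show "\<exists>d. d \<in> D \<and> d \<in> H"
    if "D \<subseteq> closed_sets X" "directed_wrt (\<le>) D" "isLub (closed_sets X) D s" "s \<in> H" for D s
    using assms(3)[of D] that isLub_closed_sets[of D X s] by (auto simp: closed_sets_def)
qed

text \<open>An open set that meets the closure of a union already meets one of the sets
  united.\<close>

lemma scott_open_hit:
  assumes "openin X U"
  shows "scott_open (closed_sets X) (hit X U)"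
  using assms by (intro scott_open_closed_setsI) (auto simp: hit_def in_closure_of; blast)+

text \<open>A closed set fails to be contained in \<open>C\<close> exactly when it meets the open
  complement of \<open>C\<close>, so the subbasis of the upper topology consists of the families
  \<open>hit X U\<close>.\<close>

lemma upper_topology_closed_sets:
  "upper_topology (closed_sets X)
   = topology_generated_by (insert (closed_sets X) {hit X U |U. openin X U})"
proof -
  have "{closed_sets X - {B \<in> closed_sets X. B \<le> C} |C. C \<in> closed_sets X} = {hit X U |U. openin X U}"
    (is "?L = ?R")
  proof
    show "?L \<subseteq> ?R"
    proof
      fix S assume "S \<in> ?L"
      then obtain C where C: "closedin X C" "S = closed_sets X - {B \<in> closed_sets X. B \<le> C}"
        by (auto simp: closed_sets_def)
      then have "S = hit X (topspace X - C)"
        by (auto simp: hit_def closed_sets_def dest: closedin_subset)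
      with C(1) show "S \<in> ?R" by blast
    qed
    show "?R \<subseteq> ?L"
    proof
      fix S assume "S \<in> ?R"
      then obtain U where U: "openin X U" "S = hit X U" by auto
      then have "S = closed_sets X - {B \<in> closed_sets X. B \<le> topspace X - U}"
        by (auto simp: hit_def closed_sets_def dest: closedin_subset openin_subset)
      with U(1) show "S \<in> ?L" by (auto simp: closed_sets_def)
    qed
  qed
  then show ?thesis by (simp add: upper_topology_def)
qed

lemma scott_open_closed_sets_finite:
  assumes H: "scott_open (closed_sets X) H" and A: "A \<in> H"
  obtains F where "finite F" "F \<subseteq> A" "X closure_of F \<in> H"
proof -
  have cA: "closedin X A" using scott_openD(1)[OF H] A by (auto simp: closed_sets_def)
  define D where "D = (\<lambda>F. X closure_of F) ` {F. finite F \<and> F \<subseteq> A}"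
  have "directed_wrt (\<subseteq>) {F. finite F \<and> F \<subseteq> A}"
    unfolding directed_wrt_def
  proof (intro conjI ballI)
    fix F G assume "F \<in> {F. finite F \<and> F \<subseteq> A}" "G \<in> {F. finite F \<and> F \<subseteq> A}"
    then show "\<exists>z\<in>{F. finite F \<and> F \<subseteq> A}. F \<subseteq> z \<and> G \<subseteq> z" by (intro bexI[of _ "F \<union> G"]) auto
  qed auto
  then have dir: "directed_wrt (\<subseteq>) D"
    unfolding D_def by (rule directed_wrt_image) (simp add: closure_of_mono)
  \<comment> \<open>As \<open>H\<close> is an upper set, covering \<open>A\<close> suffices to place
    the supremum of \<open>D\<close> in \<open>H\<close>.\<close>
  have "A \<subseteq> \<Union>D"
  proof
    fix a assume a: "a \<in> A"
    then have "a \<in> X closure_of {a}"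
      using closedin_subset[OF cA] closure_of_subset[of "{a}" X] by blast
    moreover have "X closure_of {a} \<in> D" unfolding D_def using a by blast
    ultimately show "a \<in> \<Union>D" by blast
  qed
  also have "\<Union>D \<subseteq> X closure_of \<Union>D"
    by (rule closure_of_subset) (auto simp: D_def in_closure_of)
  finally have "X closure_of \<Union>D \<in> H"
    using scott_open_closed_sets_mono[OF H A] closedin_closure_of by blast
  then obtain C where "C \<in> D" "C \<in> H"
    using scott_open_closed_setsD[OF H _ dir] by (metis D_def closedin_closure_of imageE)
  then show thesis using that by (auto simp: D_def)
qed

section \<open>Open sets of points cut out by Scott open families\<close>

lemma directed_space_openI:
  assumes "directed_space X" "U \<subseteq> topspace X"
    "\<And>D x. x \<in> U \<Longrightarrow> directed_in X D \<Longrightarrow> converges_in X D x \<Longrightarrow> \<exists>d\<in>D. d \<in> U"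
  shows "openin X U"
proof -
  have "(\<forall>D. \<forall>x\<in>U. directed_in X D \<and> converges_in X D x \<longrightarrow> D \<inter> U \<noteq> {}) \<longrightarrow> openin X U"
    using assms(1,2) by (simp add: directed_space_def)
  moreover have "D \<inter> U \<noteq> {}" if "x \<in> U" "directed_in X D \<and> converges_in X D x" for D x
    using assms(3)[of x D] that by auto
  ultimately show ?thesis by simp
qed

text \<open>This is where directedness of \<open>X\<close> enters. If a directed set
  \<open>D\<close> converges to \<open>x\<close>, the sets
  \<open>X closure_of {d} \<union> B\<close> with \<open>d \<in> D\<close> form a directed family
  whose supremum contains \<open>X closure_of {x} \<union> B\<close>. Scott openness then puts one
  of them in \<open>H\<close>.\<close>

lemma openin_closure_insert_slice:
  assumes X: "directed_space X" and H: "scott_open (closed_sets X) H" and B: "closedin X B"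
  shows "openin X {x \<in> topspace X. X closure_of {x} \<union> B \<in> H}"
proof (rule directed_space_openI[OF X])
  fix D x
  assume x: "x \<in> {x \<in> topspace X. X closure_of {x} \<union> B \<in> H}"
    and D: "directed_in X D" "converges_in X D x"
  define E where "E = (\<lambda>d. X closure_of {d} \<union> B) ` D"
  have DX: "D \<subseteq> topspace X" using D(1) by (simp add: directed_in_def)
  have mono: "X closure_of {d} \<union> B \<subseteq> X closure_of {e} \<union> B" if "specialization X d e" for d e
    using that closure_of_minimal[of "{d}" "X closure_of {e}" X] by (auto simp: specialization_def)
  have dir: "directed_wrt (\<subseteq>) E"
    unfolding E_def using D(1) mono
    by (intro directed_wrt_image[of "specialization X"]) (auto simp: directed_in_def)
  have cl: "closedin X C" if "C \<in> E" for C using that B by (auto simp: E_def)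
  have sub: "\<Union>E \<subseteq> X closure_of \<Union>E"
    using cl by (intro closure_of_subset) (auto dest: closedin_subset)
  have "D \<subseteq> \<Union>E" using DX closure_of_subset[of "{_}" X] by (auto simp: E_def)
  moreover have "x \<in> X closure_of D" using D(2) by (auto simp: converges_in_def in_closure_of)
  ultimately have "x \<in> X closure_of \<Union>E" using closure_of_mono by blast
  then have "X closure_of {x} \<subseteq> X closure_of \<Union>E" by (intro closure_of_minimal) auto
  \<comment> \<open>This uses that \<open>D\<close>, and hence \<open>E\<close>, is
    nonempty.\<close>
  moreover have "B \<subseteq> \<Union>E" using directed_wrtD(1)[OF dir] by (auto simp: E_def)
  ultimately have "X closure_of {x} \<union> B \<subseteq> X closure_of \<Union>E" using sub by blast
  moreover have "X closure_of {x} \<union> B \<in> H" using x by simp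
  ultimately have "X closure_of \<Union>E \<in> H"
    using scott_open_closed_sets_mono[OF H] closedin_closure_of by metis
  then obtain C where "C \<in> E" "C \<in> H" using scott_open_closed_setsD[OF H cl dir] by blast
  then show "\<exists>d\<in>D. d \<in> {x \<in> topspace X. X closure_of {x} \<union> B \<in> H}"
    using DX by (auto simp: E_def)
qed auto

text \<open>The map from \<open>C\<close> to its open slice is monotone and takes a directed
  supremum into the union of the slices. If \<open>V\<close> is way below that union, interpolation
  makes it way below one of the slices.\<close>

lemma scott_open_way_below_slice:
  assumes X: "directed_space X" "core_compact X" and H: "scott_open (closed_sets X) H"
  shows "scott_open (closed_sets X)
    {C. closedin X C \<and> way_below {W. openin X W} V {x \<in> topspace X. X closure_of {x} \<union> C \<in> H}}"
proof -
  define S where "S C = {x \<in> topspace X. X closure_of {x} \<union> C \<in> H}" for C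
  have mono: "S A \<subseteq> S B" if "A \<subseteq> B" "closedin X B" for A B
  proof
    fix x assume "x \<in> S A"
    then show "x \<in> S B"
      using that scott_open_closed_sets_mono[OF H, of "X closure_of {x} \<union> A" "X closure_of {x} \<union> B"]
      by (auto simp: closedin_Un le_supI2 S_def)
  qed
  have "scott_open (closed_sets X) {C. closedin X C \<and> way_below {W. openin X W} V (S C)}"
  proof (rule scott_open_closed_setsI)
    fix A B
    assume A: "A \<in> {C. closedin X C \<and> way_below {W. openin X W} V (S C)}"
      and B: "closedin X B" "A \<subseteq> B"
    then have "way_below {W. openin X W} V (S B)"
      using way_below_open_mono[of X V "S A", OF _ order_refl mono[OF B(2,1)]] by simp
    then show "B \<in> {C. closedin X C \<and> way_below {W. openin X W} V (S C)}" using B by simp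
  next
    fix D assume cl: "\<And>C. C \<in> D \<Longrightarrow> closedin X C" and dir: "directed_wrt (\<subseteq>) D"
      and sup: "X closure_of \<Union>D \<in> {C. closedin X C \<and> way_below {W. openin X W} V (S C)}"
    have "S (X closure_of \<Union>D) \<subseteq> \<Union>(S ` D)"
    proof
      fix x assume x: "x \<in> S (X closure_of \<Union>D)"
      \<comment> \<open>Joining with the fixed set \<open>X closure_of {x}\<close> commutes with the
        directed supremum, so Scott openness of \<open>H\<close> can be applied to
        \<open>E\<close>.\<close>
      define E where "E = (\<lambda>C. X closure_of {x} \<union> C) ` D"
      have dirE: "directed_wrt (\<subseteq>) E" unfolding E_def by (rule directed_wrt_image[OF dir]) blast
      have clE: "closedin X C" if "C \<in> E" for C using that cl by (auto simp: E_def)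
      have "\<Union>E = X closure_of {x} \<union> \<Union>D" using directed_wrtD(1)[OF dir] by (auto simp: E_def)
      then have "X closure_of \<Union>E \<in> H" using x by (simp add: S_def)
      then obtain C where "C \<in> E" "C \<in> H" using scott_open_closed_setsD[OF H clE dirE] by blast
      then show "x \<in> \<Union>(S ` D)" using x by (auto simp: E_def S_def)
    qed
    then have "way_below {W. openin X W} V (\<Union>(S ` D))"
      using sup way_below_open_mono[of X V _ V] by simp
    moreover have "openin X T" if "T \<in> S ` D" for T
      using that openin_closure_insert_slice[OF X(1) H] cl by (auto simp: S_def)
    moreover have "directed_wrt (\<subseteq>) (S ` D)"
      by (rule directed_wrt_image[OF dir]) (simp add: mono cl)
    ultimately obtain T where "T \<in> S ` D" "way_below {W. openin X W} V T"
      by (rule way_below_open_Union[OF X(2)])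
    then show "\<exists>C\<in>D. C \<in> {C. closedin X C \<and> way_below {W. openin X W} V (S C)}"
      using cl by auto
  qed simp
  then show ?thesis by (simp add: S_def)
qed

section \<open>The Scott and the upper topology coincide\<close>

text \<open>Induction on \<open>F\<close>, one open set for each point. The family \<open>H\<close>
  stays arbitrary because the induction hypothesis is applied to another Scott open family.\<close>

lemma scott_open_closure_finite_contains_hits:
  assumes X: "directed_space X" "core_compact X" and "finite F" "F \<subseteq> topspace X"
    and "scott_open (closed_sets X) H" "X closure_of F \<in> H"
  shows "\<exists>\<U>. finite \<U> \<and> (\<forall>U\<in>\<U>. openin X U \<and> F \<inter> U \<noteq> {}) \<and>
    {C. closedin X C \<and> (\<forall>U\<in>\<U>. C \<inter> U \<noteq> {})} \<subseteq> H"
  using assms(3-)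
proof (induction F arbitrary: H)
  case empty
  \<comment> \<open>Here \<open>H\<close> contains the empty set, the least closed set, and
    therefore every closed set.\<close>
  have "C \<in> H" if "closedin X C" for C
    using scott_open_closed_sets_mono[OF empty(2) _ empty_subsetI that] empty(3) by simp
  then show ?case by (intro exI[of _ "{}"]) auto
next
  case (insert x F)
  define S where "S C = {x \<in> topspace X. X closure_of {x} \<union> C \<in> H}" for C
  have S: "openin X (S C)" if "closedin X C" for C
    unfolding S_def using openin_closure_insert_slice[OF X(1) insert.prems(2) that] .
  have "X closure_of (insert x F) = X closure_of {x} \<union> X closure_of F"
    by (metis closure_of_Un insert_is_Un)
  then have "x \<in> S (X closure_of F)" using insert.prems by (simp add: S_def)
  then obtain V where V: "openin X V" "x \<in> V" "way_below {W. openin X W} V (S (X closure_of F))"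
    by (rule core_compactD[OF X(2) S[OF closedin_closure_of]])
  \<comment> \<open>This family takes the place of \<open>H\<close> in the induction hypothesis. It
    contains \<open>X closure_of F\<close> by the choice of \<open>V\<close>.\<close>
  have "scott_open (closed_sets X) {C. closedin X C \<and> way_below {W. openin X W} V (S C)}"
    using scott_open_way_below_slice[OF X insert.prems(2)] by (simp add: S_def)
  from insert.IH[OF _ this] insert.prems(1) V(3) obtain \<U> where
    \<U>: "finite \<U>" "\<forall>U\<in>\<U>. openin X U \<and> F \<inter> U \<noteq> {}"
    "{C. closedin X C \<and> (\<forall>U\<in>\<U>. C \<inter> U \<noteq> {})} \<subseteq> {C. closedin X C \<and> way_below {W. openin X W} V (S C)}"
    by auto
  have "C \<in> H" if C: "closedin X C" "\<forall>U\<in>insert V \<U>. C \<inter> U \<noteq> {}" for C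
  proof -
    have "way_below {W. openin X W} V (S C)" using C \<U>(3) by blast
    then have "V \<subseteq> S C" using S[OF C(1)] by (rule way_below_open_imp_subset)
    \<comment> \<open>A point \<open>y\<close> of \<open>C \<inter> V\<close> lies in
      \<open>S C\<close>. Since its closure is already inside \<open>C\<close>, the set known to be
      in \<open>H\<close> is \<open>C\<close> itself.\<close>
    then obtain y where y: "y \<in> C" "X closure_of {y} \<union> C \<in> H" using C(2) by (auto simp: S_def)
    moreover have "X closure_of {y} \<subseteq> C" using y(1) C(1) by (intro closure_of_minimal) auto
    ultimately show "C \<in> H" by (simp add: Un_absorb1)
  qed
  then show ?case using \<U>(1,2) V(1,2) by (intro exI[of _ "insert V \<U>"]) auto
qed

lemma scott_open_contains_hits:
  assumes X: "directed_space X" "core_compact X" and H: "scott_open (closed_sets X) H" "A \<in> H"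
  obtains \<U> where "finite \<U>" "\<forall>U\<in>\<U>. openin X U \<and> A \<inter> U \<noteq> {}"
    "\<forall>C. closedin X C \<and> (\<forall>U\<in>\<U>. C \<inter> U \<noteq> {}) \<longrightarrow> C \<in> H"
proof -
  obtain F where F: "finite F" "F \<subseteq> A" "X closure_of F \<in> H"
    using scott_open_closed_sets_finite[OF H] .
  have "A \<subseteq> topspace X"
    using scott_openD(1)[OF H(1)] H(2) by (auto simp: closed_sets_def dest: closedin_subset)
  then show thesis
    using scott_open_closure_finite_contains_hits[OF X F(1) _ H(1) F(3)] F(2) that by fast
qed

lemma scott_eq_upper_closed_sets:
  assumes X: "directed_space X" "core_compact X"
  shows "scott_topology (closed_sets X) = upper_topology (closed_sets X)"
proof (rule topology_eq[THEN iffD2], intro allI iffI)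
  fix H assume "openin (scott_topology (closed_sets X)) H"
  then have H: "scott_open (closed_sets X) H" by (simp add: openin_scott_topology)
  show "openin (upper_topology (closed_sets X)) H"
  proof (rule openin_subopen[THEN iffD2], intro ballI)
    fix A assume A: "A \<in> H"
    obtain \<U> where \<U>: "finite \<U>" "\<forall>U\<in>\<U>. openin X U \<and> A \<inter> U \<noteq> {}"
      "\<forall>C. closedin X C \<and> (\<forall>U\<in>\<U>. C \<inter> U \<noteq> {}) \<longrightarrow> C \<in> H"
      by (rule scott_open_contains_hits[OF X H A])
    have cA: "closedin X A" using scott_openD(1)[OF H] A by (auto simp: closed_sets_def)
    \<comment> \<open>The carrier is inserted so that the intersection is right when
      \<open>\<U>\<close> is empty.\<close>
    let ?S = "\<Inter>(insert (closed_sets X) (hit X ` \<U>))"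
    have "openin (upper_topology (closed_sets X)) ?S"
      using \<U>(1,2) unfolding upper_topology_closed_sets
      by (intro openin_Inter) (auto intro!: topology_generated_by_Basis)
    moreover have "A \<in> ?S" using cA \<U>(2) by (auto simp: hit_def closed_sets_def)
    moreover have "?S \<subseteq> H" using \<U>(3) by (auto simp: hit_def closed_sets_def)
    ultimately show "\<exists>T. openin (upper_topology (closed_sets X)) T \<and> A \<in> T \<and> T \<subseteq> H" by blast
  qed
next
  fix H assume "openin (upper_topology (closed_sets X)) H"
  then have "generate_topology_on (insert (closed_sets X) {hit X U |U. openin X U}) H"
    unfolding upper_topology_closed_sets by (rule openin_topology_generated_by)
  moreover have "scott_open (closed_sets X) S"
    if "S \<in> insert (closed_sets X) {hit X U |U. openin X U}" for S
    using that scott_open_hit[of X] scott_open_carrier[of "closed_sets X"] by auto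
  ultimately have "scott_open (closed_sets X) H"
    by (rule generate_topology_on_coarsest[where T="scott_open (closed_sets X)",
          OF istopology_scott_open, rotated])
  then show "openin (scott_topology (closed_sets X)) H" by (simp add: openin_scott_topology)
qed

section \<open>Sobriety\<close>

text \<open>The principal ideal of \<open>C\<close> is closed because its complement is
  \<open>hit X (topspace X - C)\<close>. It is the smallest closed set containing \<open>C\<close>
  because Scott closed families are lower sets.\<close>

lemma closure_of_singleton_scott_closed_sets:
  assumes "closedin X C"
  shows "scott_topology (closed_sets X) closure_of {C} = {B. closedin X B \<and> B \<subseteq> C}"
proof (rule closure_of_unique)
  have "closed_sets X - {B. closedin X B \<and> B \<subseteq> C} = hit X (topspace X - C)"
    by (auto simp: hit_def closed_sets_def dest: closedin_subset)
  moreover have "openin X (topspace X - C)" using assms by (simp add: openin_diff)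
  ultimately have "openin (scott_topology (closed_sets X)) (closed_sets X - {B. closedin X B \<and> B \<subseteq> C})"
    using scott_open_hit[of X "topspace X - C"] by (simp add: openin_scott_topology)
  then show "closedin (scott_topology (closed_sets X)) {B. closedin X B \<and> B \<subseteq> C}"
    by (subst closedin_def) (auto simp: closed_sets_def)
  fix T assume T: "{C} \<subseteq> T" "closedin (scott_topology (closed_sets X)) T"
  then have "scott_open (closed_sets X) (closed_sets X - T)"
    by (simp add: closedin_def openin_scott_topology)
  from scott_open_closed_sets_mono[OF this _ _ assms] T(1)
  show "{B. closedin X B \<and> B \<subseteq> C} \<subseteq> T" by (auto simp: closed_sets_def)
qed (use assms in auto)

text \<open>Irreducibility read on complements: two open sets that meet \<open>F\<close> meet it in
  a common point.\<close>

lemma irreducible_meets_finite_Inter: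
  assumes "irreducible_closed_in X F" "finite \<U>" "\<And>U. U \<in> \<U> \<Longrightarrow> openin X U"
    "\<And>U. U \<in> \<U> \<Longrightarrow> F \<inter> U \<noteq> {}"
  shows "\<exists>x\<in>F. \<forall>U\<in>\<U>. x \<in> U"
proof -
  have F: "F \<noteq> {}" "F \<subseteq> topspace X"
    using assms(1) by (auto simp: irreducible_closed_in_def dest: closedin_subset)
  \<comment> \<open>The induction carries an open \<open>W\<close> rather than a point, so that
    irreducibility applies again at the next step. It starts from \<open>topspace X\<close>.\<close>
  from assms(2-) have "\<exists>W. openin X W \<and> F \<inter> W \<noteq> {} \<and> (\<forall>U\<in>\<U>. W \<subseteq> U)"
  proof (induction \<U>)
    case empty
    then show ?case using F by (intro exI[of _ "topspace X"]) auto
  next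
    case (insert U \<U>)
    then obtain W where W: "openin X W" "F \<inter> W \<noteq> {}" "\<forall>U\<in>\<U>. W \<subseteq> U" by auto
    have U: "openin X U" "F \<inter> U \<noteq> {}" using insert.prems by auto
    have "\<not> F \<subseteq> topspace X - U" "\<not> F \<subseteq> topspace X - W" using U(2) W(2) by auto
    then have "\<not> F \<subseteq> (topspace X - U) \<union> (topspace X - W)"
      using assms(1) U(1) W(1) unfolding irreducible_closed_in_def by blast
    then have "F \<inter> (U \<inter> W) \<noteq> {}" using F by auto
    then show ?case using U W by (intro exI[of _ "U \<inter> W"]) auto
  qed
  then show ?thesis by blast
qed

text \<open>The generic point of \<open>F\<close> is the supremum \<open>A\<close> of its members,
  once \<open>A \<in> F\<close> is known. Otherwise finitely many families \<open>hit X U\<close>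
  contain \<open>A\<close> and have an intersection disjoint from \<open>F\<close>. Each of them
  meets \<open>F\<close>, so irreducibility yields a member of \<open>F\<close> in that
  intersection.\<close>

lemma sober_scott_closed_sets:
  assumes X: "directed_space X" "core_compact X"
  shows "sober_space (scott_topology (closed_sets X))"
  unfolding sober_space_def
proof (intro allI impI)
  let ?S = "scott_topology (closed_sets X)"
  fix F assume F: "irreducible_closed_in ?S F"
  then have clF: "closedin ?S F" by (simp add: irreducible_closed_in_def)
  then have open_co: "scott_open (closed_sets X) (closed_sets X - F)"
    by (simp add: closedin_def openin_scott_topology)
  have sub: "closedin X C" if "C \<in> F" for C
    using closedin_subset[OF clF] that by (auto simp: closed_sets_def)
  define A where "A = X closure_of \<Union>F"
  have cA: "closedin X A" by (simp add: A_def)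
  have "A \<in> F"
  proof (rule ccontr)
    assume "A \<notin> F"
    then have "A \<in> closed_sets X - F" using cA by (simp add: closed_sets_def)
    then obtain \<U> where
      \<U>: "finite \<U>" "\<forall>U\<in>\<U>. openin X U \<and> A \<inter> U \<noteq> {}"
      "\<forall>C. closedin X C \<and> (\<forall>U\<in>\<U>. C \<inter> U \<noteq> {}) \<longrightarrow> C \<in> closed_sets X - F"
      by (rule scott_open_contains_hits[OF X open_co])
    have "F \<inter> hit X U \<noteq> {}" if "U \<in> \<U>" for U
    proof -
      have "openin X U" "A \<inter> U \<noteq> {}" using \<U>(2) that by auto
      \<comment> \<open>An open set that meets the closure \<open>A\<close> of
        \<open>\<Union>F\<close> meets \<open>\<Union>F\<close>.\<close>
      then have "\<Union>F \<inter> U \<noteq> {}"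
        unfolding A_def by (auto simp: in_closure_of; blast)
      then show ?thesis using sub by (auto simp: hit_def)
    qed
    then have "\<exists>C\<in>F. \<forall>S\<in>hit X ` \<U>. C \<in> S"
      using \<U>(1,2) scott_open_hit
      by (intro irreducible_meets_finite_Inter[OF F]) (auto simp: openin_scott_topology)
    then obtain C where "C \<in> F" "\<And>U. U \<in> \<U> \<Longrightarrow> C \<in> hit X U" by blast
    then show False using \<U>(3)[rule_format, of C] sub[of C] by (auto simp: hit_def)
  qed
  have "F = {B. closedin X B \<and> B \<subseteq> A}"
  proof
    have "\<Union>F \<subseteq> A"
      unfolding A_def using sub by (intro closure_of_subset) (auto dest: closedin_subset)
    then show "F \<subseteq> {B. closedin X B \<and> B \<subseteq> A}" using sub by auto
    show "{B. closedin X B \<and> B \<subseteq> A} \<subseteq> F"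
      using closure_of_minimal[of "{A}" F ?S] clF \<open>A \<in> F\<close> cA
      by (auto simp: closure_of_singleton_scott_closed_sets)
  qed
  then show "\<exists>!C. C \<in> topspace ?S \<and> F = ?S closure_of {C}"
  proof (intro ex1I[of _ A] conjI)
    fix C assume "C \<in> topspace ?S \<and> F = ?S closure_of {C}"
    then have "closedin X C" "F = {B. closedin X B \<and> B \<subseteq> C}"
      by (simp_all add: mem_closed_sets closure_of_singleton_scott_closed_sets)
    then show "C = A" using \<open>A \<in> F\<close> \<open>F = {B. closedin X B \<and> B \<subseteq> A}\<close> by blast
  qed (use cA in \<open>simp_all add: mem_closed_sets closure_of_singleton_scott_closed_sets\<close>)
qed

section \<open>Local compactness\<close>

text \<open>Alexander's subbase theorem for a subset: it makes \<open>K\<close> compact in the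
  topology \<open>T\<close> generated by the traces of \<open>\<B>\<close> on \<open>K\<close>, and
  the inclusion of that space is continuous.\<close>

lemma compactin_topology_generated_by:
  assumes K: "K \<subseteq> \<Union>\<B>"
    and fin: "\<And>\<C>. \<C> \<subseteq> \<B> \<Longrightarrow> K \<subseteq> \<Union>\<C> \<Longrightarrow> \<exists>\<C>'. finite \<C>' \<and> \<C>' \<subseteq> \<C> \<and> K \<subseteq> \<Union>\<C>'"
  shows "compactin (topology_generated_by \<B>) K"
proof -
  define T where "T = topology (arbitrary union_of (finite intersection_of (\<lambda>x. x \<in> \<B>) relative_to K))"
  have T: "compact_space T" "topspace T = K"
    using Alexander_subbase_alt[OF K fin] by (auto simp: T_def)
  have B: "openin T (K \<inter> S)" if "S \<in> \<B>" for S
    unfolding T_def openin_subbase using that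
    by (intro arbitrary_union_of_inc relative_to_inc finite_intersection_of_inc)
  have "continuous_map T (topology_generated_by \<B>) (\<lambda>x. x)"
    using B K by (intro continuous_on_generated_topo) (auto simp: T(2) Int_commute)
  then show ?thesis using image_compactin[of T K _ "\<lambda>x. x"] T by (auto simp: compact_space_def)
qed

text \<open>
  These sets fill the gap between the neighbourhoods \<open>hit X V\<close> and \<open>hit X U\<close> when \<open>V\<close> is way below \<open>U\<close>:
  \<open>\<not> way_below V (topspace X - C)\<close> is weaker than \<open>C \<inter> V \<noteq> {}\<close> and stronger than \<open>C \<inter> U \<noteq> {}\<close>. For a cover by
  families \<open>hit X W\<close>, some \<open>V\<close> is way below the union of the \<open>W\<close>, hence below a finite subunion.
\<close>

lemma compactin_scott_way_below:
  assumes X: "directed_space X" "core_compact X"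
    and \<V>: "\<And>V. V \<in> \<V> \<Longrightarrow> openin X V"
  shows "compactin (scott_topology (closed_sets X))
    {C. closedin X C \<and> (\<forall>V\<in>\<V>. \<not> way_below {W. openin X W} V (topspace X - C))}"
    (is "compactin _ ?K")
  unfolding scott_eq_upper_closed_sets[OF X] upper_topology_closed_sets
proof (rule compactin_topology_generated_by)
  show "?K \<subseteq> \<Union>(insert (closed_sets X) {hit X U |U. openin X U})" by (auto simp: closed_sets_def)
  fix \<C> assume C: "\<C> \<subseteq> insert (closed_sets X) {hit X U |U. openin X U}" "?K \<subseteq> \<Union>\<C>"
  show "\<exists>\<C>'. finite \<C>' \<and> \<C>' \<subseteq> \<C> \<and> ?K \<subseteq> \<Union>\<C>'"
  proof (cases "closed_sets X \<in> \<C>")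
    case True
    then show ?thesis by (intro exI[of _ "{closed_sets X}"]) (auto simp: closed_sets_def)
  next
    case False
    define \<W> where "\<W> = {U. openin X U \<and> hit X U \<in> \<C>}"
    have Ceq: "\<C> = hit X ` \<W>" using C(1) False by (auto simp: \<W>_def)
    define E where "E = {\<Union>\<F> |\<F>. finite \<F> \<and> \<F> \<subseteq> \<W>}"
    have E: "openin X S" if "S \<in> E" for S using that by (auto simp: E_def \<W>_def)
    have dir: "directed_wrt (\<subseteq>) E"
      unfolding directed_wrt_def
    proof (intro conjI ballI)
      have "\<Union>{} \<in> E" unfolding E_def by blast
      then show "E \<noteq> {}" by blast
      fix S T assume "S \<in> E" "T \<in> E"
      then obtain F G where "finite F" "finite G" "F \<subseteq> \<W>" "G \<subseteq> \<W>" "S = \<Union>F" "T = \<Union>G"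
        unfolding E_def by blast
      then have "\<Union>(F \<union> G) \<in> E" "S \<subseteq> \<Union>(F \<union> G)" "T \<subseteq> \<Union>(F \<union> G)"
        unfolding E_def by (blast intro: finite_UnI)+
      then show "\<exists>Z\<in>E. S \<subseteq> Z \<and> T \<subseteq> Z" by blast
    qed
    have \<W>E: "\<Union>\<W> = \<Union>E"
    proof
      show "\<Union>\<W> \<subseteq> \<Union>E"
      proof
        fix x assume "x \<in> \<Union>\<W>"
        then obtain U where "U \<in> \<W>" "x \<in> U" by blast
        then have "\<Union>{U} \<in> E" "x \<in> \<Union>{U}" unfolding E_def by blast+
        then show "x \<in> \<Union>E" by blast
      qed
    qed (auto simp: E_def)
    have op: "openin X (\<Union>\<W>)" by (auto simp: \<W>_def)
    \<comment> \<open>This closed set belongs to no \<open>hit X W\<close> with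
      \<open>W \<in> \<W>\<close>, so the cover misses it. Being closed but outside
      \<open>?K\<close>, it must violate the condition for some \<open>V \<in> \<V>\<close>, which
      makes that \<open>V\<close> way below \<open>\<Union>\<W>\<close>.\<close>
    have "topspace X - \<Union>\<W> \<notin> ?K" using C(2) by (auto simp: Ceq hit_def)
    moreover have "topspace X - (topspace X - \<Union>\<W>) = \<Union>\<W>" using openin_subset[OF op] by blast
    ultimately obtain V where V: "V \<in> \<V>" "way_below {W. openin X W} V (\<Union>E)"
      using op \<W>E by auto
    then obtain S where S: "S \<in> E" "way_below {W. openin X W} V S"
      using way_below_open_Union[OF X(2) V(2) E dir] by blast
    then obtain \<F> where \<F>: "finite \<F>" "\<F> \<subseteq> \<W>" "S = \<Union>\<F>" unfolding E_def by blast
    have "?K \<subseteq> \<Union>(hit X ` \<F>)"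
    proof
      fix C assume C: "C \<in> ?K"
      have "\<not> S \<subseteq> topspace X - C" using C V(1) S(2) way_below_open_mono[of X V S V] by blast
      then have "C \<inter> S \<noteq> {}" using openin_subset[OF E[OF S(1)]] by blast
      then show "C \<in> \<Union>(hit X ` \<F>)" using C by (auto simp: hit_def \<F>(3))
    qed
    then show ?thesis using \<F> by (intro exI[of _ "hit X ` \<F>"]) (auto simp: Ceq)
  qed
qed

text \<open>Each \<open>U\<close> in a finite intersection of families \<open>hit X U\<close> around
  \<open>A\<close> is shrunk to some \<open>v U\<close> way below it that still meets
  \<open>A\<close>. The compact set \<open>?K\<close> then fits between the smaller intersection
  \<open>?N\<close> and \<open>H\<close>.\<close>

lemma locally_compact_scott_closed_sets:
  assumes X: "directed_space X" "core_compact X"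
  shows "locally_compact (scott_topology (closed_sets X))"
  unfolding locally_compact_def neighbourhood_base_of
proof (intro allI impI)
  let ?S = "scott_topology (closed_sets X)"
  fix H A assume "openin ?S H \<and> A \<in> H"
  then have H: "scott_open (closed_sets X) H" "A \<in> H" by (auto simp: openin_scott_topology)
  obtain \<U> where \<U>: "finite \<U>" "\<forall>U\<in>\<U>. openin X U \<and> A \<inter> U \<noteq> {}"
    "\<forall>C. closedin X C \<and> (\<forall>U\<in>\<U>. C \<inter> U \<noteq> {}) \<longrightarrow> C \<in> H"
    by (rule scott_open_contains_hits[OF X H])
  have "\<forall>U\<in>\<U>. \<exists>V. openin X V \<and> A \<inter> V \<noteq> {} \<and> way_below {W. openin X W} V U"
  proof
    fix U assume "U \<in> \<U>"
    then obtain x where x: "openin X U" "x \<in> A" "x \<in> U" using \<U>(2) by blast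
    then show "\<exists>V. openin X V \<and> A \<inter> V \<noteq> {} \<and> way_below {W. openin X W} V U"
      using core_compactD[OF X(2) x(1,3)] by blast
  qed
  then obtain v where v: "\<And>U. U \<in> \<U> \<Longrightarrow> openin X (v U)" "\<And>U. U \<in> \<U> \<Longrightarrow> A \<inter> v U \<noteq> {}"
    "\<And>U. U \<in> \<U> \<Longrightarrow> way_below {W. openin X W} (v U) U"
    by metis
  let ?N = "\<Inter>(insert (closed_sets X) ((\<lambda>U. hit X (v U)) ` \<U>))"
  let ?K = "{C. closedin X C \<and> (\<forall>V\<in>v ` \<U>. \<not> way_below {W. openin X W} V (topspace X - C))}"
  have "openin ?S ?N"
    using \<U>(1) v(1)
    by (intro openin_Inter) (auto simp: openin_scott_topology scott_open_hit scott_open_carrier)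
  moreover have "compactin ?S ?K"
    using v(1) by (intro compactin_scott_way_below[OF X]) auto
  moreover have "A \<in> ?N"
    using v(2) scott_openD(1)[OF H(1)] H(2) by (auto simp: hit_def closed_sets_def)
  moreover have "?N \<subseteq> ?K"
  proof
    fix C assume C: "C \<in> ?N"
    then have cC: "closedin X C" by (auto simp: closed_sets_def)
    \<comment> \<open>If \<open>C\<close> meets \<open>v U\<close>, then \<open>v U\<close> is not
      contained in the complement of \<open>C\<close>, still less way below it.\<close>
    have "\<not> way_below {W. openin X W} (v U) (topspace X - C)" if "U \<in> \<U>" for U
      using way_below_open_imp_subset[of X "v U" "topspace X - C"] that C cC by (auto simp: hit_def)
    then show "C \<in> ?K" using cC by auto
  qed
  moreover have "?K \<subseteq> H"
  proof
    fix C assume C: "C \<in> ?K"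
    have "C \<inter> U \<noteq> {}" if U: "U \<in> \<U>" for U
    proof
      assume "C \<inter> U = {}"
      then have "U \<subseteq> topspace X - C" using openin_subset[of X U] \<U>(2) U by blast
      then have "way_below {W. openin X W} (v U) (topspace X - C)"
        by (rule way_below_open_mono[OF v(3)[OF U] order_refl])
      then show False using C U by blast
    qed
    then show "C \<in> H" using \<U>(3) C by blast
  qed
  ultimately show "\<exists>N K. openin ?S N \<and> compactin ?S K \<and> A \<in> N \<and> N \<subseteq> K \<and> K \<subseteq> H" by blast
qed

section \<open>From the Scott topology back to the space\<close>

text \<open>
  The retraction is the preimage under \<open>x \<mapsto> X closure_of {x}\<close>; its section is \<open>U \<mapsto> hit X U\<close>.
\<close>

lemma core_compact_if_core_compact_scott:
  assumes X: "directed_space X" and S: "core_compact (scott_topology (closed_sets X))"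
  shows "core_compact X"
  unfolding core_compact_iff
proof (intro allI impI)
  let ?S = "scott_topology (closed_sets X)"
  fix U x assume U: "openin X U \<and> x \<in> U"
  have in_hit: "X closure_of {y} \<in> hit X W \<longleftrightarrow> y \<in> W" if "openin X W" "y \<in> topspace X" for y W
    using that closure_of_subset[of "{y}" X] by (auto simp: hit_def in_closure_of)
  have xX: "x \<in> topspace X" using U openin_subset by blast
  obtain H where H: "openin ?S H" "X closure_of {x} \<in> H" "way_below {W. openin ?S W} H (hit X U)"
    using core_compactD[OF S, of "hit X U" "X closure_of {x}"] U scott_open_hit[of X U] in_hit[OF _ xX]
    by (auto simp: openin_scott_topology)
  define V where "V = {y \<in> topspace X. X closure_of {y} \<in> H}"
  \<comment> \<open>This is the slice of \<open>H\<close> with the empty closed set.\<close>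
  have "openin X V"
    using openin_closure_insert_slice[OF X, of H "{}"] H(1) by (simp add: V_def openin_scott_topology)
  moreover have "x \<in> V" using H(2) xX by (simp add: V_def)
  moreover have "way_below {W. openin X W} V U"
    unfolding way_below_open
  proof (intro allI impI)
    fix D assume D: "\<forall>W\<in>D. openin X W" "directed_wrt (\<subseteq>) D" "U \<subseteq> \<Union>D"
    \<comment> \<open>The directed cover \<open>D\<close> of \<open>U\<close> is carried to a
      directed cover of \<open>hit X U\<close>, where \<open>H\<close> being way below can be
      used.\<close>
    have "openin ?S T" if "T \<in> hit X ` D" for T
      using that D(1) scott_open_hit by (auto simp: openin_scott_topology)
    moreover have "directed_wrt (\<subseteq>) (hit X ` D)"
      by (rule directed_wrt_image[OF D(2)]) (auto simp: hit_def)
    moreover have "hit X U \<subseteq> \<Union>(hit X ` D)" using D(3) by (auto simp: hit_def)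
    ultimately obtain T where T: "T \<in> hit X ` D" "H \<subseteq> T"
      by (rule way_below_openD[OF H(3)])
    then obtain W where W: "W \<in> D" "H \<subseteq> hit X W" by blast
    then have "V \<subseteq> W" using in_hit D(1) by (auto simp: V_def)
    with W show "\<exists>W\<in>D. V \<subseteq> W" by blast
  qed
  ultimately show "\<exists>V. openin X V \<and> x \<in> V \<and> way_below {W. openin X W} V U" by blast
qed

theorem theorem6p6:
  fixes X :: "'a topology"
  assumes "directed_space X"
  shows "(core_compact X \<longleftrightarrow> core_compact (scott_topology (closed_sets X))) \<and>
         (core_compact X \<longleftrightarrow>
           (sober_space (scott_topology (closed_sets X)) \<and>
            locally_compact (scott_topology (closed_sets X)) \<and>
            scott_topology (closed_sets X) = upper_topology (closed_sets X)))"
  \<comment> \<open>The cycle is: core compactness of \<open>X\<close> gives sobriety, local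
    compactness and equality of the topologies; local compactness gives core compactness of the
    Scott space; the retraction brings this back to \<open>X\<close>.\<close>
  using assms sober_scott_closed_sets locally_compact_scott_closed_sets scott_eq_upper_closed_sets
    locally_compact_imp_core_compact core_compact_if_core_compact_scott by blast

end
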